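(* Let $W,\lambda,T_C,E_C,D>0$ and let $n\ge1$ be an integer. Consider minimizing $$\sum_{i=1}^n (w_is_i^2+E_C)\left(1+\lambda\left(\frac{w_i}{s_i}+T_C\right)\right)$$ over $w_1,\dots,w_n>0$ with $\sum_i w_i=W$ and $s_1,\dots,s_n>0$, subject to $$\sum_{i=1}^n 2\left(\frac{w_i}{s_i}+T_C\right)\le D.$$ In any optimal solution, all chunks have equal size $w_i=W/n$ and all speeds $s_i$ are equal.
   Context: This is the divisible-workload, single-speed model with a hard (worst-case) deadline $D$. Chunk $i$ has size $w_i$ and is executed at speed $s_i$, then re-executed once at the same speed in case of failure. $\lambda$ is the failure rate, $T_C$ the checkpoint time, and $E_C$ the checkpoint energy. *)

theory Defs
  imports Complex_Main
begin

text \<open>Chunks are indexed by \<open>1, \<dots>, n\<close>; the values of \<open>w\<close> and \<open>s\<close> outside this range are irrelevant.\<close>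

definition expected_energy ::
  "nat \<Rightarrow> real \<Rightarrow> real \<Rightarrow> real \<Rightarrow> (nat \<Rightarrow> real) \<Rightarrow> (nat \<Rightarrow> real) \<Rightarrow> real" where
  "expected_energy n lambda TC EC w s =
     (\<Sum>i=1..n. (w i * (s i)\<^sup>2 + EC) * (1 + lambda * (w i / s i + TC)))"

text \<open>In the worst case every chunk is executed twice, hence the factor 2.\<close>

definition worst_case_time ::
  "nat \<Rightarrow> real \<Rightarrow> (nat \<Rightarrow> real) \<Rightarrow> (nat \<Rightarrow> real) \<Rightarrow> real" where
  "worst_case_time n TC w s = (\<Sum>i=1..n. 2 * (w i / s i + TC))"

definition feasible ::
  "nat \<Rightarrow> real \<Rightarrow> real \<Rightarrow> real \<Rightarrow> (nat \<Rightarrow> real) \<Rightarrow> (nat \<Rightarrow> real) \<Rightarrow> bool" where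
  "feasible n W TC D w s \<longleftrightarrow>
     (\<forall>i\<in>{1..n}. w i > 0) \<and> (\<forall>i\<in>{1..n}. s i > 0) \<and>
     (\<Sum>i=1..n. w i) = W \<and> worst_case_time n TC w s \<le> D"

definition optimal ::
  "nat \<Rightarrow> real \<Rightarrow> real \<Rightarrow> real \<Rightarrow> real \<Rightarrow> real \<Rightarrow> (nat \<Rightarrow> real) \<Rightarrow> (nat \<Rightarrow> real) \<Rightarrow> bool" where
  "optimal n W lambda TC EC D w s \<longleftrightarrow>
     feasible n W TC D w s \<and>
     (\<forall>w' s'. feasible n W TC D w' s' \<longrightarrow>
        expected_energy n lambda TC EC w s \<le> expected_energy n lambda TC EC w' s')"

end

theory Submission
  imports Defs
begin

text \<open>In the variables \<open>w\<close> and \<open>t = w / s\<close> the constraints are linear, and the energy of a chunk is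
  \<open>(1 + \<lambda> T\<^sub>C) w\<^sup>3 / t\<^sup>2 + \<lambda> w\<^sup>3 / t\<close> plus an affine function of \<open>t\<close>. The first summand is convex
  and the second strictly convex, so replacing every pair \<open>(w\<^sub>i, t\<^sub>i)\<close> by the average pair preserves
  feasibility and strictly lowers the energy unless all pairs coincide. Convexity is used in the
  form of the tangent plane inequality at the average.\<close>

text \<open>The left side is the tangent plane at \<open>(1, 1)\<close>; multiplied by
  \<open>y\<^sup>2\<close>, the gap factors as \<open>(x - y)\<^sup>2 * (x + 2 * y)\<close>.
  Equality holds on the whole ray \<open>x = y\<close>, so strictness must come from the other
  summand.\<close>

lemma cube_over_square_tangent:
  fixes x y :: real
  assumes "x > 0" "y > 0"
  shows "3 * x - 2 * y \<le> x ^ 3 / y\<^sup>2"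
proof -
  have "0 \<le> (x - y)\<^sup>2 * (x + 2 * y)"
    using assms by simp
  also have "\<dots> = x ^ 3 - (3 * x - 2 * y) * y\<^sup>2"
    by algebra
  finally show ?thesis
    using assms by (simp add: pos_le_divide_eq)
qed

text \<open>Again the tangent plane at \<open>(1, 1)\<close>, but now touching only there; this is
  what makes the optimum unique.\<close>

lemma cube_over_linear_tangent:
  fixes x y :: real
  assumes "x > 0" "y > 0" "x \<noteq> 1 \<or> y \<noteq> 1"
  shows "3 * x - y - 1 < x ^ 3 / y"
proof -
  have "0 < x ^ 3 - (3 * x - y - 1) * y"
  proof (cases "x \<le> 1 / 4")
    case True
    then have "0 \<le> (1 - 3 * x) * y"
      using assms by simp
    then have "0 < x ^ 3 + y\<^sup>2 + (1 - 3 * x) * y"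
      using assms by (simp add: add_pos_nonneg add_pos_pos)
    then show ?thesis
      by (simp add: algebra_simps power2_eq_square)
  next
    case False
    have eq: "x ^ 3 - (3 * x - y - 1) * y
        = (y - (3 * x - 1) / 2)\<^sup>2 + (x - 1)\<^sup>2 * (4 * x - 1) / 4"
      by (simp add: field_simps power2_eq_square power3_eq_cube)
    show ?thesis
    proof (cases "x = 1")
      case True
      then show ?thesis
        using assms unfolding eq by simp
    next
      case x: False
      then have "0 < (x - 1)\<^sup>2 * (4 * x - 1) / 4"
        using False by simp
      then show ?thesis
        unfolding eq by (simp add: add_nonneg_pos)
    qed
  qed
  then show ?thesis
    using assms by (simp add: pos_less_divide_eq)
qed

text \<open>Here \<open>t\<close> is the execution time of the chunk, so its speed is
  \<open>w / t\<close>.\<close>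

definition chunk_energy :: "real \<Rightarrow> real \<Rightarrow> real \<Rightarrow> real \<Rightarrow> real \<Rightarrow> real" where
  "chunk_energy lambda TC EC w t = (w ^ 3 / t\<^sup>2 + EC) * (1 + lambda * (t + TC))"

lemma expected_energy_eq_sum_chunk_energy:
  assumes "\<forall>i\<in>{1..n}. w i > 0 \<and> s i > 0"
  shows "expected_energy n lambda TC EC w s
    = (\<Sum>i=1..n. chunk_energy lambda TC EC (w i) (w i / s i))"
  unfolding expected_energy_def
proof (rule sum.cong[OF refl])
  fix i assume "i \<in> {1..n}"
  then have "w i > 0" "s i > 0"
    using assms by auto
  then have "w i ^ 3 / (w i / s i)\<^sup>2 = w i * (s i)\<^sup>2"
    by (simp add: field_simps power2_eq_square power3_eq_cube)
  then show "(w i * (s i)\<^sup>2 + EC) * (1 + lambda * (w i / s i + TC))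
    = chunk_energy lambda TC EC (w i) (w i / s i)"
    by (simp add: chunk_energy_def)
qed

text \<open>Rescaling by \<open>w0\<close> and \<open>t0\<close> moves the point of tangency to
  \<open>(1, 1)\<close>. The witnesses \<open>A\<close> and \<open>B\<close> are the partial
  derivatives at \<open>(w0, t0)\<close>; their values do not matter later, only that they are
  independent of \<open>w\<close> and \<open>t\<close>.\<close>

lemma chunk_energy_tangent:
  fixes lambda TC EC w0 t0 :: real
  assumes "lambda > 0" "TC > 0" "w0 > 0" "t0 > 0"
  obtains A B where
    "\<And>w t. w > 0 \<Longrightarrow> t > 0 \<Longrightarrow> w \<noteq> w0 \<or> t \<noteq> t0 \<Longrightarrow>
      A * (w - w0) + B * (t - t0) < chunk_energy lambda TC EC w t - chunk_energy lambda TC EC w0 t0"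
proof
  \<comment> \<open>\<open>P\<close> and \<open>Q\<close> are the values at \<open>(w0, t0)\<close>
    of the convex and the strictly convex summand.\<close>
  define P where "P = (1 + lambda * TC) * w0 ^ 3 / t0\<^sup>2"
  define Q where "Q = lambda * w0 ^ 3 / t0"
  have pos: "P > 0" "Q > 0"
    using assms by (simp_all add: P_def Q_def add_pos_pos)
  fix w t :: real
  assume wt: "w > 0" "t > 0" "w \<noteq> w0 \<or> t \<noteq> t0"
  define x y where "x = w / w0" and "y = t / t0"
  have xy: "x > 0" "y > 0" "x \<noteq> 1 \<or> y \<noteq> 1"
    using wt assms by (auto simp: x_def y_def)
  have w: "w = x * w0" and t: "t = y * t0"
    using assms by (simp_all add: x_def y_def)
  have energy: "chunk_energy lambda TC EC (a * w0) (b * t0)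
      = P * (a ^ 3 / b\<^sup>2) + Q * (a ^ 3 / b) + EC * (1 + lambda * (b * t0 + TC))"
    if "b > 0" for a b
    using that assms unfolding chunk_energy_def P_def Q_def
    by (simp add: field_simps power2_eq_square power3_eq_cube)
  have energy0: "chunk_energy lambda TC EC w0 t0 = P + Q + EC * (1 + lambda * (t0 + TC))"
    using energy[of 1 1] by simp
  have "P * (3 * x - 2 * y) + Q * (3 * x - y - 1) < P * (x ^ 3 / y\<^sup>2) + Q * (x ^ 3 / y)"
    using cube_over_square_tangent[OF xy(1,2)] cube_over_linear_tangent[OF xy] pos
    by (intro add_le_less_mono mult_left_mono mult_strict_left_mono) auto
  moreover have "(3 * (P + Q) / w0) * (w - w0) = 3 * (P + Q) * (x - 1)"
    using assms by (simp add: w field_simps)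
  moreover have "(EC * lambda - (2 * P + Q) / t0) * (t - t0)
      = EC * lambda * (t - t0) - (2 * P + Q) * (y - 1)"
    using assms by (simp add: t field_simps)
  ultimately show "(3 * (P + Q) / w0) * (w - w0) + (EC * lambda - (2 * P + Q) / t0) * (t - t0)
      < chunk_energy lambda TC EC w t - chunk_energy lambda TC EC w0 t0"
    unfolding energy0 unfolding w t energy[OF xy(2)] by (simp add: algebra_simps)
qed

theorem theorem2:
  fixes W lambda TC EC D :: real and n :: nat and w s :: "nat \<Rightarrow> real"
  assumes "W > 0" and "lambda > 0" and "TC > 0" and "EC > 0" and "D > 0"
    and "n \<ge> 1"
    and "optimal n W lambda TC EC D w s"
  shows "(\<forall>i\<in>{1..n}. w i = W / real n) \<and> (\<forall>i\<in>{1..n}. \<forall>j\<in>{1..n}. s i = s j)"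
proof -
  define t where "t i = w i / s i" for i
  define w0 where "w0 = W / real n"
  define t0 where "t0 = (\<Sum>i=1..n. t i) / real n"
  let ?E = "chunk_energy lambda TC EC"
  have feas: "\<forall>i\<in>{1..n}. w i > 0 \<and> s i > 0" "(\<Sum>i=1..n. w i) = W" "worst_case_time n TC w s \<le> D"
    and opt: "\<And>w' s'. feasible n W TC D w' s' \<Longrightarrow>
        expected_energy n lambda TC EC w s \<le> expected_energy n lambda TC EC w' s'"
    using assms(7) by (auto simp: optimal_def feasible_def)
  have t_pos: "t i > 0" if "i \<in> {1..n}" for i
    using feas(1) that by (simp add: t_def)
  have w0: "w0 > 0" and sum_w: "(\<Sum>i=1..n. w i - w0) = 0"
    using assms(1,6) feas(2) by (simp_all add: w0_def sum_subtractf)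
  have "(\<Sum>i=1..n. t i) > 0"
    using t_pos assms(6) by (intro sum_pos) auto
  then have t0: "t0 > 0" and sum_t: "(\<Sum>i=1..n. t i - t0) = 0"
    using assms(6) by (simp_all add: t0_def sum_subtractf)
  \<comment> \<open>The competitor runs equal chunks at speed \<open>w0 / t0\<close>, so each takes
    exactly the mean time \<open>t0\<close> and the worst-case time is unchanged.\<close>
  have avg: "w0 / (w0 / t0) = t0" and s0: "w0 / t0 > 0" and sum_w0: "real n * w0 = W"
    using w0 t0 assms(1,6) by (simp_all add: w0_def)
  have "worst_case_time n TC (\<lambda>_. w0) (\<lambda>_. w0 / t0) = worst_case_time n TC w s"
    using assms(6) unfolding worst_case_time_def avg t_def[symmetric]
    by (simp add: t0_def sum.distrib distrib_left flip: sum_distrib_left)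
  then have "feasible n W TC D (\<lambda>_. w0) (\<lambda>_. w0 / t0)"
    using feas(3) w0 s0 sum_w0 by (simp add: feasible_def)
  from opt[OF this] have le: "(\<Sum>i=1..n. ?E (w i) (t i) - ?E w0 t0) \<le> 0"
    using feas(1) w0 t0
    by (simp add: expected_energy_eq_sum_chunk_energy avg sum_subtractf t_def)
  obtain A B where tangent: "\<And>w t. w > 0 \<Longrightarrow> t > 0 \<Longrightarrow> w \<noteq> w0 \<or> t \<noteq> t0 \<Longrightarrow>
      A * (w - w0) + B * (t - t0) < ?E w t - ?E w0 t0"
    using chunk_energy_tangent[OF assms(2,3) w0 t0] by blast
  have equal: "w i = w0 \<and> t i = t0" if i: "i \<in> {1..n}" for i
  proof (rule ccontr)
    assume ne: "\<not> ?thesis"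
    \<comment> \<open>One deviating chunk makes the summed inequality strict; the left side is 0
      because deviations from a mean cancel, which contradicts \<open>le\<close>.\<close>
    have "(\<Sum>i=1..n. A * (w i - w0) + B * (t i - t0)) < (\<Sum>i=1..n. ?E (w i) (t i) - ?E w0 t0)"
    proof (rule sum_strict_mono_ex1)
      show "\<forall>j\<in>{1..n}. A * (w j - w0) + B * (t j - t0) \<le> ?E (w j) (t j) - ?E w0 t0"
      proof
        fix j assume j: "j \<in> {1..n}"
        show "A * (w j - w0) + B * (t j - t0) \<le> ?E (w j) (t j) - ?E w0 t0"
        proof (cases "w j = w0 \<and> t j = t0")
          case False
          then show ?thesis
            using tangent[of "w j" "t j"] feas(1) t_pos[OF j] j by auto
        qed simp
      qed
      show "\<exists>j\<in>{1..n}. A * (w j - w0) + B * (t j - t0) < ?E (w j) (t j) - ?E w0 t0"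
        using tangent[of "w i" "t i"] feas(1) t_pos[OF i] i ne by blast
    qed simp
    moreover have "(\<Sum>i=1..n. A * (w i - w0) + B * (t i - t0)) = 0"
      using sum_w sum_t by (simp add: sum.distrib flip: sum_distrib_left)
    ultimately show False
      using le by simp
  qed
  have "s i = w0 / t0" if "i \<in> {1..n}" for i
    using equal[OF that] w0 feas(1) that by (auto simp: t_def)
  then show ?thesis
    using equal by (simp add: w0_def)
qed

end
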